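(* Let $X\neq\emptyset$ be a set and let $\mathcal E\colon \mathcal F(X)\to[0,\infty]$ be convex with $\mathcal E(0)=0$. Assume that $\mathcal E$ is lower semicontinuous and positively $p$-homogeneous for some $1\le p<\infty$, and let $q\in(1,\infty]$ with $p^{-1}+q^{-1}=1$. Let $x,y\in X$ and $t>0$. If $p>1$, then $$\mathcal R_t(x,y)=(p-1)\left(\frac tp\right)^qR(x,y)^q\quad\text{and}\quad\mathcal R_{t,\infty}(x)=(p-1)\left(\frac tp\right)^qR_\infty(x)^q.$$ If $p=1$, then $$\mathcal R_t(x,y)=\begin{cases}0&\text{if }R(x,y)\le\frac1t\\\infty&\text{if }R(x,y)>\frac1t\end{cases}\quad\text{and}\quad\mathcal R_{t,\infty}(x)=\begin{cases}0&\text{if }R_\infty(x)\le\frac1t\\\infty&\text{if }R_\infty(x)>\frac1t.\end{cases}$$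
   Context: $\mathcal F(X)$ is the real vector space of all functions $f\colon X\to\mathbb R$, equipped with the topology of pointwise convergence. $\mathcal E$ is lower semicontinuous if $\mathcal E(f)\le\liminf_i\mathcal E(f_i)$ for every net $(f_i)$ converging pointwise to $f$. $\mathcal E$ is positively $p$-homogeneous if $\mathcal E(\lambda f)=\lambda^p\mathcal E(f)$ for all $f\in\mathcal F(X)$ and $\lambda\ge0$ (with $0\cdot\infty=0$). For $x,y\in X$ and $t>0$ define, with values in $[0,\infty]$: - elementary resistances: $R(x,y)=\sup\{f(x)-f(y)\mid\mathcal E(f)\le1\}$ and $R_\infty(x)=\sup\{f(x)\mid\mathcal E(f)\le1\}$; - $t$-resistances: $\mathcal R_t(x,y)=\sup\{t(f(x)-f(y))-\mathcal E(f)\mid f\in\mathcal F(X)\}$ and $\mathcal R_{t,\infty}(x)=\sup\{tf(x)-\mathcal E(f)\mid f\in\mathcal F(X)\}$. The convention $\infty^q=\infty$ is used. *)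

theory Defs
  imports "HOL-Analysis.Analysis"
begin

(* The set X is the carrier of the type 'a, and F(X) is the type 'a \<Rightarrow> real with the
   vector space operations written out pointwise. *)

definition convex_functional :: "(('a \<Rightarrow> real) \<Rightarrow> ennreal) \<Rightarrow> bool" where
  "convex_functional E \<longleftrightarrow>
     (\<forall>f g. \<forall>u\<in>{0..1}.
        E (\<lambda>x. (1 - u) * f x + u * g x) \<le> ennreal (1 - u) * E f + ennreal u * E g)"

(* Nets are rendered by filters on the function space (the image of the tail filter of a net);
   lsc_functional_netD below recovers the condition for families over any index type. *)
definition lsc_functional :: "(('a \<Rightarrow> real) \<Rightarrow> ennreal) \<Rightarrow> bool" where
  "lsc_functional E \<longleftrightarrow>
     (\<forall>f F. (\<forall>x. ((\<lambda>g. g x) \<longlongrightarrow> f x) F) \<longrightarrow> E f \<le> Liminf F E)"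

lemma lsc_functional_netD:
  assumes "lsc_functional E" and "\<And>x. ((\<lambda>i. h i x) \<longlongrightarrow> f x) F"
  shows "E f \<le> Liminf F (\<lambda>i. E (h i))"
proof -
  have "\<forall>x. ((\<lambda>g. g x) \<longlongrightarrow> f x) (filtermap h F)"
    using assms(2) by (simp add: filterlim_filtermap)
  then have "E f \<le> Liminf (filtermap h F) E"
    using assms(1) unfolding lsc_functional_def by blast
  also have "\<dots> \<le> Liminf F (\<lambda>i. E (h i))"
    by (rule Liminf_filtermap_le)
  finally show ?thesis .
qed

(* On ennreal, 0 * \<infinity> = 0. *)
definition pos_homogeneous :: "real \<Rightarrow> (('a \<Rightarrow> real) \<Rightarrow> ennreal) \<Rightarrow> bool" where
  "pos_homogeneous p E \<longleftrightarrow>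
     (\<forall>f. \<forall>l\<ge>0. E (\<lambda>x. l * f x) = ennreal (l powr p) * E f)"

(* The suprema below are taken in ereal; when E 0 = 0 the zero function is admissible,
   so they are nonnegative, i.e. lie in [0, \<infinity>], as the four lemmas at the end confirm. *)

definition resistance :: "(('a \<Rightarrow> real) \<Rightarrow> ennreal) \<Rightarrow> 'a \<Rightarrow> 'a \<Rightarrow> ereal" where
  "resistance E x y = (SUP f\<in>{f. E f \<le> 1}. ereal (f x - f y))"

definition resistance_inf :: "(('a \<Rightarrow> real) \<Rightarrow> ennreal) \<Rightarrow> 'a \<Rightarrow> ereal" where
  "resistance_inf E x = (SUP f\<in>{f. E f \<le> 1}. ereal (f x))"

definition t_resistance :: "(('a \<Rightarrow> real) \<Rightarrow> ennreal) \<Rightarrow> real \<Rightarrow> 'a \<Rightarrow> 'a \<Rightarrow> ereal" where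
  "t_resistance E t x y = (SUP f. ereal (t * (f x - f y)) - enn2ereal (E f))"

definition t_resistance_inf :: "(('a \<Rightarrow> real) \<Rightarrow> ennreal) \<Rightarrow> real \<Rightarrow> 'a \<Rightarrow> ereal" where
  "t_resistance_inf E t x = (SUP f. ereal (t * f x) - enn2ereal (E f))"

(* Real powers on [0, \<infinity>] with \<infinity> ^ q = \<infinity>; only meaningful for a \<ge> 0 and q > 0. *)
definition ereal_powr :: "ereal \<Rightarrow> real \<Rightarrow> ereal" where
  "ereal_powr a q = (if a = \<infinity> then \<infinity> else ereal (real_of_ereal a powr q))"

lemma resistance_nonneg: "E (\<lambda>_. 0) = 0 \<Longrightarrow> 0 \<le> resistance E x y"
  unfolding resistance_def by (rule SUP_upper2[of "\<lambda>_. 0"]) auto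

lemma resistance_inf_nonneg: "E (\<lambda>_. 0) = 0 \<Longrightarrow> 0 \<le> resistance_inf E x"
  unfolding resistance_inf_def by (rule SUP_upper2[of "\<lambda>_. 0"]) auto

lemma t_resistance_nonneg: "E (\<lambda>_. 0) = 0 \<Longrightarrow> 0 \<le> t_resistance E t x y"
  unfolding t_resistance_def by (rule SUP_upper2[of "\<lambda>_. 0"]) (auto simp: zero_ennreal.rep_eq)

lemma t_resistance_inf_nonneg: "E (\<lambda>_. 0) = 0 \<Longrightarrow> 0 \<le> t_resistance_inf E t x"
  unfolding t_resistance_inf_def by (rule SUP_upper2[of "\<lambda>_. 0"]) (auto simp: zero_ennreal.rep_eq)

end

theory Submission
  imports Defs
begin

text \<open>Both kinds of resistance evaluate a homogeneous functional \<open>L\<close>, namely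
  \<open>L f = f x - f y\<close> or \<open>L f = f x\<close>. Rescaling \<open>f\<close> gives \<open>L f \<le> R * E f powr (1 / p)\<close>, so each
  value \<open>t * L f - E f\<close> is at most \<open>t * R * s - s powr p\<close> for some \<open>s \<ge> 0\<close>, and Young's
  inequality bounds this by \<open>(p - 1) * (t * R / p) powr q\<close>. Conversely, if \<open>E f \<le> 1\<close>, the
  multiple \<open>s * f\<close> with the \<open>s\<close> that gives equality in Young's inequality attains the bound
  with \<open>L f\<close> in place of \<open>R\<close>. For \<open>p = 1\<close> the same two estimates are linear in \<open>s\<close>.\<close>

text \<open>Young's inequality multiplied by \<open>p\<close>, with \<open>p / q = p - 1\<close>.
  For \<open>b = t * r / p\<close> the left side becomes
  \<open>t * r * s - s powr p\<close>.\<close>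

lemma Young_scaled:
  fixes p q s b :: real
  assumes "1 < p" "1 / p + 1 / q = 1" "0 \<le> s" "0 \<le> b"
  shows "p * b * s - s powr p \<le> (p - 1) * b powr q"
proof -
  have "q > 1" using assms(1,2) by (smt (verit, ccfv_SIG) divide_less_eq_1_pos divide_pos_pos zero_less_divide_1_iff divide_le_0_1_iff)
  have "p / q = p - 1" using assms(1,2) by (simp add: field_simps)
  have "s * b \<le> s powr p / p + b powr q / q"
    using assms \<open>q > 1\<close> by (intro Youngs_inequality) auto
  then have "p * (s * b) \<le> p * (s powr p / p + b powr q / q)"
    using assms(1) by (intro mult_left_mono) auto
  also have "\<dots> = s powr p + (p / q) * b powr q"
    using assms(1) by (simp add: distrib_left)
  finally show ?thesis
    unfolding \<open>p / q = p - 1\<close> by (simp add: mult_ac)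
qed

text \<open>The equality case of Young's inequality: \<open>s = b powr (q - 1)\<close> satisfies
  \<open>s powr p = b powr q\<close> because \<open>(q - 1) * p = q\<close>.\<close>

lemma Young_scaled_eq:
  fixes p q b :: real
  assumes "1 < p" "1 / p + 1 / q = 1" "0 \<le> b"
  shows "p * b * b powr (q - 1) - (b powr (q - 1)) powr p = (p - 1) * b powr q"
proof -
  have "q \<noteq> 0" using assms(1,2) by auto
  then have "(q - 1) * p = q" using assms(1,2) by (simp add: field_simps)
  moreover have "b * b powr (q - 1) = b powr q"
    using assms(3) by (simp add: powr_mult_base)
  ultimately show ?thesis
    by (simp add: powr_powr left_diff_distrib mult.assoc)
qed

locale homogeneous_pairing =
  fixes E :: "('a \<Rightarrow> real) \<Rightarrow> ennreal" and L :: "('a \<Rightarrow> real) \<Rightarrow> real" and p t :: real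
  assumes E_zero: "E (\<lambda>_. 0) = 0"
    and E_homogeneous: "pos_homogeneous p E"
    and L_homogeneous: "\<And>c f. L (\<lambda>x. c * f x) = c * L f"
    and p_ge_1: "1 \<le> p"
    and t_pos: "0 < t"
begin

definition R :: ereal where
  "R = (SUP f\<in>{f. E f \<le> 1}. ereal (L f))"

definition T :: ereal where
  "T = (SUP f. ereal (t * L f) - enn2ereal (E f))"

lemma E_scale: "0 \<le> c \<Longrightarrow> E (\<lambda>x. c * f x) = ennreal (c powr p) * E f"
  using E_homogeneous unfolding pos_homogeneous_def by blast

lemma L_zero: "L (\<lambda>_. 0) = 0"
  using L_homogeneous[of 0] by simp

lemma R_nonneg: "0 \<le> R"
  unfolding R_def by (rule SUP_upper2[of "\<lambda>_. 0"]) (auto simp: E_zero L_zero)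

lemma T_nonneg: "0 \<le> T"
  unfolding T_def by (rule SUP_upper2[of "\<lambda>_. 0"]) (auto simp: E_zero L_zero zero_ennreal.rep_eq)

text \<open>A function of positive energy is rescaled to energy one. At energy zero every
  nonnegative multiple of \<open>f\<close> is admissible for \<open>R\<close>, which forces
  \<open>L f \<le> 0\<close>.\<close>

lemma L_le:
  assumes "R \<le> ereal r" "E f = ennreal e" "0 \<le> e"
  shows "L f \<le> r * e powr (1 / p)"
proof (cases "e = 0")
  case True
  have bound: "c * L f \<le> r" if "0 \<le> c" for c
  proof -
    have "ereal (L (\<lambda>x. c * f x)) \<le> R"
      unfolding R_def using that True assms(2) by (intro SUP_upper) (simp add: E_scale)
    then show ?thesis using assms(1) by (simp add: L_homogeneous) (metis ereal_less_eq(3) order_trans)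
  qed
  have "L f \<le> 0"
  proof (rule ccontr)
    assume "\<not> L f \<le> 0"
    moreover have "0 \<le> r" using bound[of 0] by simp
    \<comment> \<open>On this multiple of \<open>f\<close> the functional \<open>L\<close> would
      take the value \<open>r + 1\<close>.\<close>
    ultimately show False using bound[of "(r + 1) / L f"] by simp
  qed
  then show ?thesis using True by simp
next
  case False
  then have "0 < e" using assms(3) by simp
  define c where "c = e powr (- (1 / p))"
  have "c powr p = inverse e"
    unfolding c_def powr_powr using \<open>0 < e\<close> p_ge_1 by (simp add: powr_minus)
  have "0 \<le> c" by (simp add: c_def)
  then have "E (\<lambda>x. c * f x) = 1"
    using \<open>0 < e\<close> \<open>c powr p = inverse e\<close> assms(2) by (simp add: E_scale flip: ennreal_mult)
  then have "ereal (L (\<lambda>x. c * f x)) \<le> R"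
    unfolding R_def by (intro SUP_upper) simp
  then have "c * L f \<le> r"
    using assms(1) by (simp add: L_homogeneous) (metis ereal_less_eq(3) order_trans)
  then show ?thesis
    using \<open>0 < e\<close> by (simp add: c_def powr_minus field_simps)
qed

text \<open>With \<open>s = e powr (1 / p)\<close> the energy \<open>e\<close> is
  \<open>s powr p\<close>, so a bound in one real variable suffices. Functions of infinite energy
  contribute \<open>-\<infinity>\<close>.\<close>

lemma T_le:
  assumes "R \<le> ereal r" and bound: "\<And>s. 0 \<le> s \<Longrightarrow> t * r * s - s powr p \<le> C"
  shows "T \<le> ereal C"
  unfolding T_def
proof (rule SUP_least)
  fix f
  show "ereal (t * L f) - enn2ereal (E f) \<le> ereal C"
  proof (cases "E f")
    case (real e)
    then have "t * L f - e \<le> t * (r * e powr (1 / p)) - e"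
      using L_le[OF assms(1)] t_pos by simp
    also have "\<dots> = t * r * e powr (1 / p) - (e powr (1 / p)) powr p"
      using p_ge_1 real by (simp add: powr_powr)
    also have "\<dots> \<le> C" by (rule bound) simp
    finally show ?thesis using real by (simp add: enn2ereal_ennreal)
  qed simp
qed

text \<open>The multiple \<open>s * f\<close> competes in the supremum \<open>T\<close>, and its
  energy is at most \<open>s powr p\<close>.\<close>

lemma T_ge:
  assumes "E f \<le> 1" "0 \<le> s"
  shows "ereal (t * L f * s - s powr p) \<le> T"
proof -
  have "E (\<lambda>x. s * f x) \<le> ennreal (s powr p)"
    using assms mult_left_mono[OF assms(1), of "ennreal (s powr p)"] by (simp add: E_scale)
  then have "enn2ereal (E (\<lambda>x. s * f x)) \<le> ereal (s powr p)"
    by (metis enn2ereal_ennreal less_eq_ennreal.rep_eq powr_ge_zero)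
  then have "ereal (t * (s * L f)) - ereal (s powr p)
      \<le> ereal (t * L (\<lambda>x. s * f x)) - enn2ereal (E (\<lambda>x. s * f x))"
    unfolding L_homogeneous by (intro ereal_minus_mono) auto
  also have "\<dots> \<le> T"
    unfolding T_def by (rule SUP_upper) simp
  finally show ?thesis by (simp add: mult_ac)
qed

text \<open>For the lower bound, a finite \<open>T\<close> is turned into a bound on each admissible
  \<open>L f\<close>. This shows that \<open>R\<close> is finite and avoids exchanging the supremum
  with the power.\<close>

lemma T_eq_powr:
  assumes "1 < p" "1 / p + 1 / q = 1"
  shows "T = ereal ((p - 1) * (t / p) powr q) * ereal_powr R q"
proof (rule antisym)
  define c where "c = (p - 1) * (t / p) powr q"
  have "0 < c" using assms t_pos by (simp add: c_def)
  have "0 < 1 / q" using assms by (smt (verit) divide_less_eq_1_pos)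
  then have "0 < q" by simp
  have c_powr: "c * r powr q = (p - 1) * (t * r / p) powr q" if "0 \<le> r" for r
    using that t_pos assms(1) powr_mult[of "t / p" r q] by (simp add: c_def)
  show "T \<le> ereal ((p - 1) * (t / p) powr q) * ereal_powr R q"
  proof (cases R)
    case (real r)
    then have "0 \<le> r" using R_nonneg by simp
    have "T \<le> ereal (c * r powr q)"
    proof (rule T_le)
      show "t * r * s - s powr p \<le> c * r powr q" if "0 \<le> s" for s
        using Young_scaled[OF assms that, of "t * r / p"] \<open>0 \<le> r\<close> t_pos assms(1)
        by (simp add: c_powr)
    qed (simp add: real)
    then show ?thesis using real by (simp add: ereal_powr_def c_def)
  next
    case PInf
    then show ?thesis using \<open>0 < c\<close> by (simp add: ereal_powr_def flip: c_def)
  qed (use R_nonneg in simp)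
  show "ereal ((p - 1) * (t / p) powr q) * ereal_powr R q \<le> T"
  proof (cases T)
    case (real u)
    then have "0 \<le> u" using T_nonneg by simp
    have "R \<le> ereal ((u / c) powr (1 / q))"
      unfolding R_def
    proof (rule SUP_least)
      fix f assume "f \<in> {f. E f \<le> 1}"
      then have f: "E f \<le> 1" by simp
      show "ereal (L f) \<le> ereal ((u / c) powr (1 / q))"
      proof (cases "0 \<le> L f")
        case True
        \<comment> \<open>This makes \<open>p * b = t * L f\<close>, so \<open>T_ge\<close> at
          \<open>s = b powr (q - 1)\<close> meets the equality case of Young's inequality.\<close>
        define b where "b = t * L f / p"
        have "0 \<le> b" using True t_pos assms(1) by (simp add: b_def)
        have "c * L f powr q = p * b * b powr (q - 1) - (b powr (q - 1)) powr p"
          using Young_scaled_eq[OF assms \<open>0 \<le> b\<close>] True by (simp add: c_powr b_def)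
        also have "\<dots> \<le> u"
          using T_ge[OF f, of "b powr (q - 1)"] assms(1) real by (simp add: b_def)
        finally have "L f powr q \<le> u / c"
          using \<open>0 < c\<close> by (simp add: field_simps)
        then have "(L f powr q) powr (1 / q) \<le> (u / c) powr (1 / q)"
          using \<open>0 < q\<close> by (intro powr_mono2) auto
        then show ?thesis using True \<open>0 < q\<close> by (simp add: powr_powr)
      next
        case False
        \<comment> \<open>A negative value lies below any real power.\<close>
        then show ?thesis by (smt (verit) ereal_less_eq(3) powr_ge_zero)
      qed
    qed
    then obtain r where r: "R = ereal r" "0 \<le> r" "r \<le> (u / c) powr (1 / q)"
      using R_nonneg by (cases R) auto
    then have "r powr q \<le> ((u / c) powr (1 / q)) powr q"
      using \<open>0 < q\<close> by (intro powr_mono2) auto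
    also have "\<dots> = u / c"
      using \<open>0 < q\<close> \<open>0 < c\<close> \<open>0 \<le> u\<close> by (simp add: powr_powr)
    finally have "c * r powr q \<le> u"
      using \<open>0 < c\<close> by (simp add: field_simps)
    then show ?thesis using r real by (simp add: ereal_powr_def c_def)
  qed (use T_nonneg in simp_all)
qed

text \<open>For \<open>p = 1\<close> the value along a ray is \<open>(t * L f - 1) * s\<close>,
  linear in \<open>s\<close>: either it is never positive or it is unbounded.\<close>

lemma T_eq_indicator:
  assumes "p = 1"
  shows "T = (if R \<le> ereal (1 / t) then 0 else \<infinity>)"
proof (cases "R \<le> ereal (1 / t)")
  case True
  then have "T \<le> ereal 0"
    \<comment> \<open>With \<open>r = 1 / t\<close> the expression
      \<open>t * r * s - s powr 1\<close> vanishes.\<close>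
    by (rule T_le) (use assms t_pos in simp)
  then show ?thesis using True T_nonneg by (simp add: zero_ereal_def)
next
  case False
  then obtain f where f: "E f \<le> 1" "1 / t < L f"
    unfolding R_def by (auto simp: not_le less_SUP_iff)
  then have "0 < t * L f - 1" using t_pos by (simp add: field_simps)
  have "T = \<infinity>"
  proof (rule ereal_top)
    fix B
    \<comment> \<open>Solves \<open>(t * L f - 1) * s = max 0 B\<close>; the maximum keeps
      \<open>s\<close> nonnegative.\<close>
    define s where "s = max 0 B / (t * L f - 1)"
    have "0 \<le> s" using \<open>0 < t * L f - 1\<close> by (simp add: s_def)
    have "B \<le> (t * L f - 1) * s"
      using \<open>0 < t * L f - 1\<close> by (simp add: s_def)
    also have "\<dots> = t * L f * s - s powr p"
      using \<open>0 \<le> s\<close> assms by (simp add: algebra_simps)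
    finally show "ereal B \<le> T"
      using T_ge[OF f(1) \<open>0 \<le> s\<close>] by (metis ereal_less_eq(3) order_trans)
  qed
  then show ?thesis using False by simp
qed

end

theorem theorem4p6:
  fixes E :: "('a \<Rightarrow> real) \<Rightarrow> ennreal" and p t :: real and q :: ereal and x y :: 'a
  assumes "convex_functional E" and "E (\<lambda>_. 0) = 0"
    and "lsc_functional E"
    and "1 \<le> p" and "pos_homogeneous p E"
    and "1 < q" and "inverse (ereal p) + inverse q = 1"
    and "0 < t"
  shows
    "(1 < p \<longrightarrow>
        t_resistance E t x y =
          ereal ((p - 1) * (t / p) powr real_of_ereal q) *
          ereal_powr (resistance E x y) (real_of_ereal q) \<and>
        t_resistance_inf E t x =
          ereal ((p - 1) * (t / p) powr real_of_ereal q) *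
          ereal_powr (resistance_inf E x) (real_of_ereal q)) \<and>
     (p = 1 \<longrightarrow>
        t_resistance E t x y = (if resistance E x y \<le> ereal (1 / t) then 0 else \<infinity>) \<and>
        t_resistance_inf E t x = (if resistance_inf E x \<le> ereal (1 / t) then 0 else \<infinity>))"
proof -
  interpret diff: homogeneous_pairing E "\<lambda>f. f x - f y" p t
    using assms by unfold_locales (auto simp: algebra_simps)
  interpret eval: homogeneous_pairing E "\<lambda>f. f x" p t
    using assms by unfold_locales auto
  \<comment> \<open>The value \<open>q = \<infinity>\<close> would give \<open>1 / p = 1\<close>, so
    for \<open>1 < p\<close> the exponent is finite and \<open>real_of_ereal q\<close> is its true
    value.\<close>
  have conj: "1 / p + 1 / real_of_ereal q = 1" if "1 < p"
    using assms(6,7) that by (cases q) (auto simp: inverse_eq_divide one_ereal_def)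
  have "diff.T = t_resistance E t x y" "diff.R = resistance E x y"
    "eval.T = t_resistance_inf E t x" "eval.R = resistance_inf E x"
    by (simp_all add: diff.T_def diff.R_def eval.T_def eval.R_def t_resistance_def
        resistance_def t_resistance_inf_def resistance_inf_def)
  then show ?thesis
    using diff.T_eq_powr[OF _ conj] eval.T_eq_powr[OF _ conj]
      diff.T_eq_indicator eval.T_eq_indicator by simp
qed

end
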